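(* Let $X,Y$ be Banach spaces, $D\subset X$ a nonempty open convex set, and $F:D\to Y$ a twice continuously (Fréchet) differentiable operator. Assume that there is $x_0\in D$ such that $F'(x_0)^{-1}$ exists and that, for some $R>0$, $h:[0,R)\to\mathbb{R}$ is a majorizing function to $F$ at $x_0$. Let $t^*$ be the smallest zero of $h$ in $(0,R)$, and let $x^*$ be the limit of the Halley sequence $\{x_k\}$ for $F$ started at $x_0$. Then $x^*$ is the unique zero of $F$ in $B(x_0,\rho)$, where $$\rho:=\sup\{t\in[t^*,R):h(t)\le0\}.$$
   Context: $B(x,r)$ is the open ball with center $x$ and radius $r$. $I$ is the identity operator. $L_F(x)=\frac12F'(x)^{-1}F''(x)F'(x)^{-1}F(x)$, i.e. the bounded linear operator $v\mapsto\frac12F'(x)^{-1}F''(x)\big(F'(x)^{-1}F(x),v\big)$ on $X$. Majorizing function: let $R>0$ and $F'(x_0)$ be nonsingular (boundedly invertible). A twice continuously differentiable $h:[0,R)\to\mathbb{R}$ is a majorizing function to $F$ at $x_0$ if $B(x_0,R)\subset D$ and all of the following hold: (1) $\|F'(x_0)^{-1}[F''(y)-F''(x)]\|\le h''(\|y-x\|+\|x-x_0\|)-h''(\|x-x_0\|)$ for all $x,y\in B(x_0,R)$ with $\|y-x\|+\|x-x_0\|<R$; (2) $\|F'(x_0)^{-1}F(x_0)\|\le h(0)$ and $\|F'(x_0)^{-1}F''(x_0)\|\le h''(0)$; (3) $h(0)>0$, $h''(0)>0$, $h'(0)=-1$; (4) $h''$ is convex and strictly increasing on $[0,R)$; (5)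 $h$ has a zero in $(0,R)$ and, denoting by $t^*$ its smallest zero, $h'(t^* )<0$. Halley sequence for $F$: $x_{k+1}=x_k-[I-L_F(x_k)]^{-1}F'(x_k)^{-1}F(x_k)$, $k\ge0$; under the stated hypotheses it is well defined, contained in $B(x_0,t^* )$, and converges to a point $x^*\in\overline{B(x_0,t^* )}$ with $F(x^* )=0$. *)

theory Defs
  imports "HOL-Analysis.Analysis"
begin

definition blinfun_nonsingular :: "('a::real_normed_vector \<Rightarrow>\<^sub>L 'b::real_normed_vector) \<Rightarrow> bool"
  where "blinfun_nonsingular A \<longleftrightarrow> (\<exists>B. A o\<^sub>L B = id_blinfun \<and> B o\<^sub>L A = id_blinfun)"

text \<open>Unspecified when the operator is singular.\<close>

definition blinfun_inv ::
    "('a::real_normed_vector \<Rightarrow>\<^sub>L 'b::real_normed_vector) \<Rightarrow> ('b \<Rightarrow>\<^sub>L 'a)"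
  where "blinfun_inv A = (THE B. A o\<^sub>L B = id_blinfun \<and> B o\<^sub>L A = id_blinfun)"

text \<open>A second derivative, i.e. a bounded bilinear map, is represented as an element of
  \<open>'a \<Rightarrow>\<^sub>L 'a \<Rightarrow>\<^sub>L 'b\<close>; the operator norm of that type is the usual norm of bilinear maps.
  The next operation is the composition of an operator with such a map: it sends \<open>(u, v)\<close>
  to \<open>A (B u v)\<close>.\<close>

lift_definition blinfun_comp_bilinear ::
    "('b::real_normed_vector \<Rightarrow>\<^sub>L 'c::real_normed_vector) \<Rightarrow>
     ('a::real_normed_vector \<Rightarrow>\<^sub>L 'a \<Rightarrow>\<^sub>L 'b) \<Rightarrow> ('a \<Rightarrow>\<^sub>L 'a \<Rightarrow>\<^sub>L 'c)"
  is "\<lambda>A B u. A o\<^sub>L blinfun_apply B u"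
  by (intro bounded_linear_intros blinfun.bounded_linear_right)

lemma blinfun_comp_bilinear_apply [simp]:
  "blinfun_apply (blinfun_apply (blinfun_comp_bilinear A B) u) v = A (B u v)"
  by (simp add: blinfun_comp_bilinear.rep_eq)

definition C2_on ::
    "'a::real_normed_vector set \<Rightarrow> ('a \<Rightarrow> 'b::real_normed_vector) \<Rightarrow>
     ('a \<Rightarrow> 'a \<Rightarrow>\<^sub>L 'b) \<Rightarrow> ('a \<Rightarrow> 'a \<Rightarrow>\<^sub>L 'a \<Rightarrow>\<^sub>L 'b) \<Rightarrow> bool"
  where "C2_on D F F' F'' \<longleftrightarrow>
    (\<forall>x\<in>D. (F has_derivative blinfun_apply (F' x)) (at x)) \<and>
    (\<forall>x\<in>D. (F' has_derivative blinfun_apply (F'' x)) (at x)) \<and>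
    continuous_on D F''"

definition L_op ::
    "('a::real_normed_vector \<Rightarrow> 'b::real_normed_vector) \<Rightarrow> ('a \<Rightarrow> 'a \<Rightarrow>\<^sub>L 'b) \<Rightarrow>
     ('a \<Rightarrow> 'a \<Rightarrow>\<^sub>L 'a \<Rightarrow>\<^sub>L 'b) \<Rightarrow> 'a \<Rightarrow> ('a \<Rightarrow>\<^sub>L 'a)"
  where "L_op F F' F'' x =
    (1/2) *\<^sub>R (blinfun_inv (F' x) o\<^sub>L F'' x (blinfun_inv (F' x) (F x)))"

primrec halley_seq ::
    "('a::real_normed_vector \<Rightarrow> 'b::real_normed_vector) \<Rightarrow> ('a \<Rightarrow> 'a \<Rightarrow>\<^sub>L 'b) \<Rightarrow>
     ('a \<Rightarrow> 'a \<Rightarrow>\<^sub>L 'a \<Rightarrow>\<^sub>L 'b) \<Rightarrow> 'a \<Rightarrow> nat \<Rightarrow> 'a"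
  where
    "halley_seq F F' F'' x0 0 = x0"
  | "halley_seq F F' F'' x0 (Suc k) =
      (let x = halley_seq F F' F'' x0 k in
       x - blinfun_inv (id_blinfun - L_op F F' F'' x) (blinfun_inv (F' x) (F x)))"

definition halley_well_defined ::
    "'a::real_normed_vector set \<Rightarrow> ('a \<Rightarrow> 'b::real_normed_vector) \<Rightarrow> ('a \<Rightarrow> 'a \<Rightarrow>\<^sub>L 'b) \<Rightarrow>
     ('a \<Rightarrow> 'a \<Rightarrow>\<^sub>L 'a \<Rightarrow>\<^sub>L 'b) \<Rightarrow> 'a \<Rightarrow> bool"
  where "halley_well_defined D F F' F'' x0 \<longleftrightarrow>
    (\<forall>k. halley_seq F F' F'' x0 k \<in> D \<and>
         blinfun_nonsingular (F' (halley_seq F F' F'' x0 k)) \<and>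
         blinfun_nonsingular (id_blinfun - L_op F F' F'' (halley_seq F F' F'' x0 k)))"

definition smallest_zero :: "(real \<Rightarrow> real) \<Rightarrow> real \<Rightarrow> real \<Rightarrow> bool"
  where "smallest_zero h R t \<longleftrightarrow>
    t \<in> {0<..<R} \<and> h t = 0 \<and> (\<forall>s\<in>{0<..<R}. h s = 0 \<longrightarrow> t \<le> s)"

text \<open>Only the values of \<open>h\<close>, \<open>h'\<close>, \<open>h''\<close> on \<open>[0, R)\<close> matter; the derivatives at \<open>0\<close> are one-sided.\<close>

definition majorizing_function ::
    "'a::real_normed_vector set \<Rightarrow> ('a \<Rightarrow> 'b::real_normed_vector) \<Rightarrow> ('a \<Rightarrow> 'a \<Rightarrow>\<^sub>L 'b) \<Rightarrow>
     ('a \<Rightarrow> 'a \<Rightarrow>\<^sub>L 'a \<Rightarrow>\<^sub>L 'b) \<Rightarrow> 'a \<Rightarrow> real \<Rightarrow>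
     (real \<Rightarrow> real) \<Rightarrow> (real \<Rightarrow> real) \<Rightarrow> (real \<Rightarrow> real) \<Rightarrow> bool"
  where "majorizing_function D F F' F'' x0 R h h' h'' \<longleftrightarrow>
    R > 0 \<and> blinfun_nonsingular (F' x0) \<and> ball x0 R \<subseteq> D \<and>
    (\<forall>t\<in>{0..<R}. (h has_real_derivative h' t) (at t within {0..<R})) \<and>
    (\<forall>t\<in>{0..<R}. (h' has_real_derivative h'' t) (at t within {0..<R})) \<and>
    continuous_on {0..<R} h'' \<and>
    (\<forall>x\<in>ball x0 R. \<forall>y\<in>ball x0 R. norm (y - x) + norm (x - x0) < R \<longrightarrow>
       norm (blinfun_comp_bilinear (blinfun_inv (F' x0)) (F'' y - F'' x))
         \<le> h'' (norm (y - x) + norm (x - x0)) - h'' (norm (x - x0))) \<and>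
    norm (blinfun_inv (F' x0) (F x0)) \<le> h 0 \<and>
    norm (blinfun_comp_bilinear (blinfun_inv (F' x0)) (F'' x0)) \<le> h'' 0 \<and>
    h 0 > 0 \<and> h'' 0 > 0 \<and> h' 0 = -1 \<and>
    convex_on {0..<R} h'' \<and> strict_mono_on {0..<R} h'' \<and>
    (\<exists>t. smallest_zero h R t \<and> h' t < 0)"

end

theory Submission
  imports Defs
begin

text \<open>Put \<open>G = F'(x\<^sub>0)\<^sup>-\<^sup>1 F\<close>; the Halley steps of \<open>F\<close> and \<open>G\<close> agree, and the majorant conditions bound
  the second-order Taylor remainders of \<open>G\<close> and \<open>G'\<close> by those of \<open>h\<close> and \<open>h'\<close>. With \<open>d\<close> the
  Halley correction at \<open>x\<close>,
  \<open>G (x + d) = 1/2 G''(x)(L d, d) + remainder\<close>, and the same identity holds for the scalar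
  Halley step of \<open>h\<close>. Hence \<open>\<parallel>x - x\<^sub>0\<parallel> \<le> t\<close>, \<open>\<parallel>G x\<parallel> \<le> h t\<close> is propagated along the two Halley
  iterations, whose increments are then compared. The scalar iterates increase and stay below \<open>t\<^sup>*\<close>,
  so they converge, and since a scalar step is at least \<open>h t\<close>, the limit of the \<open>x\<^sub>k\<close> is a zero.

  For uniqueness, a zero of \<open>G\<close> at distance \<open>r\<close> from \<open>x\<^sub>0\<close> forces \<open>0 \<le> h r\<close>, which excludes
  \<open>t\<^sup>* < r < \<rho>\<close> by strict convexity of \<open>h\<close>; and on the closed ball of radius \<open>t\<^sup>*\<close> the map
  \<open>G - I\<close> is Lipschitz with constant \<open>1 + h' t\<^sup>* < 1\<close>, so \<open>G\<close> is injective there.\<close>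

section \<open>Inverses of bounded operators\<close>

text \<open>Two-sided inverses are unique, which is what gives the definite description in
  \<open>blinfun_inv\<close> a usable value.\<close>

lemma blinfun_inv_eqI:
  assumes "A o\<^sub>L B = id_blinfun" "B o\<^sub>L A = id_blinfun"
  shows "blinfun_inv A = B"
  unfolding blinfun_inv_def
proof (rule the_equality)
  fix C assume C: "A o\<^sub>L C = id_blinfun \<and> C o\<^sub>L A = id_blinfun"
  have "C y = B y" for y
  proof -
    have "C (A (B y)) = B y" "A (B y) = y"
      using C assms by (metis blinfun_apply_blinfun_compose blinfun_apply_id_blinfun id_apply)+
    then show ?thesis by simp
  qed
  then show "C = B" by (rule blinfun_eqI)
qed (use assms in blast)

lemma blinfun_inv_apply:
  assumes "blinfun_nonsingular A"
  shows "A (blinfun_inv A y) = y" "blinfun_inv A (A x) = x"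
proof -
  obtain B where B: "A o\<^sub>L B = id_blinfun" "B o\<^sub>L A = id_blinfun"
    using assms unfolding blinfun_nonsingular_def by blast
  then have "blinfun_inv A = B" by (rule blinfun_inv_eqI)
  with B show "A (blinfun_inv A y) = y" "blinfun_inv A (A x) = x"
    by (metis blinfun_apply_blinfun_compose blinfun_apply_id_blinfun id_apply)+
qed

lemma blinfun_nonsingularI:
  fixes A :: "'a::real_normed_vector \<Rightarrow>\<^sub>L 'b::real_normed_vector"
    and B :: "'b \<Rightarrow>\<^sub>L 'a"
  assumes "\<And>y. A (B y) = y" "\<And>x. B (A x) = x"
  shows "blinfun_nonsingular A"
  unfolding blinfun_nonsingular_def
  by (rule exI[of _ B]) (auto intro!: blinfun_eqI simp: assms)

text \<open>Solving \<open>T x = y\<close> means finding a fixed point of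
  \<open>x \<mapsto> y - (T x - x)\<close>, a contraction with constant \<open>q\<close>, so
  Banach's theorem gives surjectivity. The lower bound
  \<open>(1 - q) * norm x \<le> norm (T x)\<close> gives injectivity and bounds the inverse.\<close>

lemma neumann_nonsingular:
  fixes T :: "'a::banach \<Rightarrow>\<^sub>L 'a"
  assumes T: "\<And>x. norm (T x - x) \<le> q * norm x" and q: "0 \<le> q" "q < 1"
  shows "blinfun_nonsingular T" and "norm (blinfun_inv T y) \<le> norm y / (1 - q)"
proof -
  have lower: "(1 - q) * norm x \<le> norm (T x)" for x
  proof -
    have "norm x \<le> norm (T x) + norm (T x - x)"
      using norm_triangle_ineq4[of "T x" "T x - x"] by simp
    with T[of x] show ?thesis by (simp add: algebra_simps)
  qed
  have "\<exists>x. T x = y" for y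
  proof -
    let ?f = "\<lambda>x. y - (T x - x)"
    have "dist (?f x) (?f z) \<le> q * dist x z" for x z
    proof -
      have "?f x - ?f z = - (T (x - z) - (x - z))"
        by (simp add: blinfun.bilinear_simps)
      then show ?thesis using T[of "x - z"] by (metis dist_norm norm_minus_cancel)
    qed
    then obtain x where "?f x = x" using banach_fix_type[OF q, of ?f] by blast
    then show ?thesis by (intro exI[of _ x]) (simp add: algebra_simps)
  qed
  then obtain g where g: "\<And>y. T (g y) = y" by metis
  have inj: "x = z" if "T x = T z" for x z
    using lower[of "x - z"] that q by (simp add: blinfun.bilinear_simps mult_le_0_iff)
  have bound: "norm (g y) \<le> norm y / (1 - q)" for y
    using lower[of "g y"] q by (simp add: g field_simps)
  have "bounded_linear g"
  proof (rule bounded_linear_intro[of _ "1 / (1 - q)"])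
    show "g (y + z) = g y + g z" for y z
      by (rule inj) (simp add: g blinfun.bilinear_simps)
    show "g (c *\<^sub>R y) = c *\<^sub>R g y" for c y
      by (rule inj) (simp add: g blinfun.bilinear_simps)
    show "norm (g y) \<le> norm y * (1 / (1 - q))" for y
      using bound by simp
  qed
  then have G: "blinfun_apply (Blinfun g) = g" by (rule bounded_linear_Blinfun_apply)
  show ns: "blinfun_nonsingular T"
    by (rule blinfun_nonsingularI[where B = "Blinfun g"]) (simp_all add: G g inj)
  have "blinfun_inv T y = g y"
    by (rule inj) (simp add: g blinfun_inv_apply[OF ns])
  then show "norm (blinfun_inv T y) \<le> norm y / (1 - q)" using bound by simp
qed

section \<open>Scalar majorants\<close>

text \<open>Both \<open>a + u\<close> and \<open>b\<close> lie between \<open>a\<close> and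
  \<open>b + u\<close>, with mirrored weights; adding the two convexity inequalities gives the
  claim. It later allows the distance to \<open>x0\<close> in the majorant condition to be replaced
  by an upper bound.\<close>

lemma convex_on_increment_mono:
  fixes f :: "real \<Rightarrow> real"
  assumes f: "convex_on S f" and S: "a \<in> S" "b + u \<in> S" and ab: "a \<le> b" "0 \<le> u"
  shows "f (a + u) - f a \<le> f (b + u) - f b"
proof (cases "b - a + u = 0")
  case True
  then have "b = a" using ab by linarith
  then show ?thesis by simp
next
  case False
  \<comment> \<open>\<open>l\<close> is the weight of \<open>b + u\<close> in \<open>a + u\<close>;
    in \<open>b\<close> the same endpoint has weight \<open>1 - l\<close>.\<close>
  define l where "l = u / (b - a + u)"
  have l: "0 \<le> l" "l \<le> 1" "l * (b - a + u) = u"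
    using False ab by (auto simp: l_def field_simps)
  have "(1 - l) *\<^sub>R a + l *\<^sub>R (b + u) = a + u" "(1 - (1 - l)) *\<^sub>R a + (1 - l) *\<^sub>R (b + u) = b"
    using l(3) by (auto simp: algebra_simps)
  moreover have "f ((1 - l) *\<^sub>R a + l *\<^sub>R (b + u)) \<le> (1 - l) * f a + l * f (b + u)"
    "f ((1 - (1 - l)) *\<^sub>R a + (1 - l) *\<^sub>R (b + u)) \<le> (1 - (1 - l)) * f a + (1 - l) * f (b + u)"
    by (rule convex_onD[OF f]; use l S in simp)+
  ultimately show ?thesis by (simp add: algebra_simps)
qed

locale halley_majorant =
  fixes h h' h'' :: "real \<Rightarrow> real" and R tstar :: real
  assumes h_deriv: "\<And>t. t \<in> {0..<R} \<Longrightarrow> (h has_real_derivative h' t) (at t within {0..<R})"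
    and h'_deriv: "\<And>t. t \<in> {0..<R} \<Longrightarrow> (h' has_real_derivative h'' t) (at t within {0..<R})"
    and h_0: "h 0 > 0" and h'_0: "h' 0 = -1" and h''_0: "h'' 0 > 0"
    and h''_convex: "convex_on {0..<R} h''" and h''_strict: "strict_mono_on {0..<R} h''"
    and tstar: "smallest_zero h R tstar" and h'_tstar: "h' tstar < 0"
begin

lemma tstar_bounds: "0 < tstar" "tstar < R" "h tstar = 0"
  using tstar by (auto simp: smallest_zero_def)

lemma h''_mono: "0 \<le> s \<Longrightarrow> s \<le> t \<Longrightarrow> t < R \<Longrightarrow> h'' s \<le> h'' t"
  using strict_mono_onD[OF h''_strict, of s t] by (cases "s = t") auto

lemma h''_pos: "0 \<le> t \<Longrightarrow> t < R \<Longrightarrow> 0 < h'' t"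
  using h''_mono[of 0 t] h''_0 by simp

lemma at_within_eq: "0 < t \<Longrightarrow> t < R \<Longrightarrow> at t within {0..<R} = at t"
  by (rule at_within_open_subset[of _ "{0<..<R}"]) auto

lemma continuous_on_h: "continuous_on {0..<R} h" and continuous_on_h': "continuous_on {0..<R} h'"
  using DERIV_continuous_on[OF h_deriv] DERIV_continuous_on[OF h'_deriv] by blast+

text \<open>Taylor remainders are compared along segments with parameter \<open>u\<close> in [0,1],
  shared by the scalar and the operator side. For \<open>0 < u < 1\<close> and \<open>0 < s\<close>
  the point \<open>t + u * s\<close> is interior, where the derivative within \<open>{0..<R}\<close>
  is an ordinary one.\<close>

lemma deriv_along:
  assumes "0 \<le> t" "0 < s" "t + s < R" "0 < u" "u < 1"
  shows "((\<lambda>u. h (t + u * s)) has_real_derivative h' (t + u * s) * s) (at u)"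
    and "((\<lambda>u. h' (t + u * s)) has_real_derivative h'' (t + u * s) * s) (at u)"
proof -
  have "u * s < s" "0 < u * s" using assms by auto
  then have i: "0 < t + u * s" "t + u * s < R" using assms by linarith+
  have d: "(h has_real_derivative h' (t + u * s)) (at (t + u * s))"
    "(h' has_real_derivative h'' (t + u * s)) (at (t + u * s))"
    using h_deriv[of "t + u * s"] h'_deriv[of "t + u * s"] i by (auto simp: at_within_eq)
  have e: "((\<lambda>u. t + u * s) has_real_derivative s) (at u)"
    by (auto intro!: derivative_eq_intros)
  show "((\<lambda>u. h (t + u * s)) has_real_derivative h' (t + u * s) * s) (at u)"
    "((\<lambda>u. h' (t + u * s)) has_real_derivative h'' (t + u * s) * s) (at u)"
    by (rule DERIV_chain2[OF d(1) e], rule DERIV_chain2[OF d(2) e])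
qed

lemma continuous_along:
  assumes "0 \<le> t" "0 \<le> s" "t + s < R"
  shows "continuous_on {0..1} (\<lambda>u. h (t + u * s))" "continuous_on {0..1} (\<lambda>u. h' (t + u * s))"
proof -
  have "0 \<le> t + u * s \<and> t + u * s < R" if "0 \<le> u" "u \<le> 1" for u
    using mult_right_mono[OF that(2) assms(2)] that assms by auto
  then have i: "(\<lambda>u. t + u * s) ` {0..1} \<subseteq> {0..<R}" by auto
  have c: "continuous_on {0..1} (\<lambda>u. t + u * s)" by (intro continuous_intros)
  show "continuous_on {0..1} (\<lambda>u. h (t + u * s))" "continuous_on {0..1} (\<lambda>u. h' (t + u * s))"
    by (rule continuous_on_compose2[OF continuous_on_h c i],
        rule continuous_on_compose2[OF continuous_on_h' c i])
qed

text \<open>Along the segment the difference of the two sides has derivative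
  \<open>s * (h'' (t + u * s) - h'' t)\<close>, nonnegative because \<open>h''\<close>
  increases.\<close>

lemma h'_lower:
  assumes "0 \<le> t" "0 \<le> s" "t + s < R"
  shows "h' t + s * h'' t \<le> h' (t + s)"
proof (cases "s = 0")
  case False
  with assms have s: "0 < s" by simp
  have "h' (t + 0 * s) - 0 * s * h'' t \<le> h' (t + 1 * s) - 1 * s * h'' t"
  proof (rule DERIV_nonneg_imp_increasing_open[of 0 1])
    fix u :: real assume u: "0 < u" "u < 1"
    have "((\<lambda>u. h' (t + u * s) - u * s * h'' t) has_real_derivative h'' (t + u * s) * s - s * h'' t) (at u)"
      by (auto intro!: derivative_eq_intros deriv_along assms s u)
    moreover have "u * s < s" "0 < u * s" using s u by auto
    then have "h'' t \<le> h'' (t + u * s)"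
      using assms by (intro h''_mono) auto
    then have "0 \<le> h'' (t + u * s) * s - s * h'' t" using s by (simp add: mult.commute)
    ultimately show "\<exists>y. ((\<lambda>u. h' (t + u * s) - u * s * h'' t) has_real_derivative y) (at u) \<and> 0 \<le> y"
      by blast
  qed (auto intro!: continuous_intros continuous_along assms)
  then show ?thesis by simp
qed simp

text \<open>This is \<open>h'_lower\<close> integrated once more along the segment.\<close>

lemma h_lower:
  assumes "0 \<le> t" "0 \<le> s" "t + s < R"
  shows "h t + s * h' t + s\<^sup>2 / 2 * h'' t \<le> h (t + s)"
proof (cases "s = 0")
  case False
  with assms have s: "0 < s" by simp
  let ?e = "\<lambda>u. h (t + u * s) - u * s * h' t - (u * s)\<^sup>2 / 2 * h'' t"
  have "?e 0 \<le> ?e 1"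
  proof (rule DERIV_nonneg_imp_increasing_open[of 0 1])
    fix u :: real assume u: "0 < u" "u < 1"
    have "(?e has_real_derivative h' (t + u * s) * s - s * h' t - (u * s) * s * h'' t) (at u)"
      by (auto intro!: derivative_eq_intros deriv_along assms s u simp: power2_eq_square)
    moreover have "u * s < s" "0 < u * s" using s u by auto
    then have "h' t + (u * s) * h'' t \<le> h' (t + u * s)"
      using assms by (intro h'_lower) auto
    from mult_left_mono[OF this, of s]
    have "0 \<le> h' (t + u * s) * s - s * h' t - (u * s) * s * h'' t"
      using s by (simp add: algebra_simps)
    ultimately show "\<exists>y. (?e has_real_derivative y) (at u) \<and> 0 \<le> y"
      by blast
  qed (auto intro!: continuous_intros continuous_along assms)
  then show ?thesis by simp
qed simp

lemma h'_strict:
  assumes "0 \<le> s" "s < t" "t < R"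
  shows "h' s < h' t"
proof -
  have "0 < (t - s) * h'' s" using assms h''_pos[of s] by simp
  then show ?thesis using h'_lower[of s "t - s"] assms by simp
qed

lemma h'_neg: "0 \<le> t \<Longrightarrow> t \<le> tstar \<Longrightarrow> h' t < 0"
  using h'_strict[of t tstar] h'_tstar tstar_bounds by (cases "t = tstar") auto

lemma h'_ge: "0 \<le> t \<Longrightarrow> t < R \<Longrightarrow> -1 \<le> h' t"
  using h'_strict[of 0 t] h'_0 by (cases "t = 0") auto

text \<open>Since \<open>h 0 > 0\<close>, a nonpositive value before \<open>tstar\<close> would
  produce an earlier zero by the intermediate value theorem.\<close>

lemma h_pos:
  assumes "0 \<le> t" "t < tstar"
  shows "0 < h t"
proof (rule ccontr)
  assume "\<not> 0 < h t"
  then have "h t \<le> 0" by simp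
  moreover have "continuous_on {0..t} h"
    by (rule continuous_on_subset[OF continuous_on_h]) (use assms tstar_bounds in auto)
  ultimately obtain s where s: "0 \<le> s" "s \<le> t" "h s = 0"
    using IVT2'[of h t 0 0] h_0 assms by auto
  with h_0 have "s \<noteq> 0" by auto
  then show False using tstar s assms tstar_bounds by (auto simp: smallest_zero_def)
qed

text \<open>If \<open>h r\<close> were nonnegative, the mean value theorem on both sides of
  \<open>r\<close> would give points \<open>y < r < z\<close> with
  \<open>h' z \<le> 0 \<le> h' y\<close>, against the strict growth of \<open>h'\<close>.\<close>

lemma h_neg:
  assumes "tstar < r" "r < s" "s < R" "h s \<le> 0"
  shows "h r < 0"
proof (rule ccontr)
  assume r: "\<not> h r < 0"
  have mvt: "\<exists>z. a < z \<and> z < b \<and> h b - h a = (b - a) * h' z"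
    if "0 \<le> a" "a < b" "b < R" for a b
  proof -
    have d: "DERIV h x :> h' x" if "a < x" "x < b" for x
      using h_deriv[of x] at_within_eq[of x] that \<open>0 \<le> a\<close> \<open>b < R\<close> by auto
    have "continuous_on {a..b} h"
      by (rule continuous_on_subset[OF continuous_on_h]) (use that in auto)
    then obtain l z where z: "a < z" "z < b" "DERIV h z :> l" "h b - h a = (b - a) * l"
      using MVT[OF \<open>a < b\<close>] d real_differentiable_def by metis
    with DERIV_unique[OF z(3) d] show ?thesis by blast
  qed
  obtain y z where y: "tstar < y" "y < r" "h r - h tstar = (r - tstar) * h' y"
    and z: "r < z" "z < s" "h s - h r = (s - r) * h' z"
    using mvt[of tstar r] mvt[of r s] assms tstar_bounds by auto
  have "0 \<le> (r - tstar) * h' y" using y r tstar_bounds by simp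
  then have "0 \<le> h' y" using assms by (simp add: zero_le_mult_iff)
  have "(s - r) * h' z \<le> 0" using z r assms by simp
  then have "h' z \<le> 0" using assms by (simp add: mult_le_0_iff)
  with \<open>0 \<le> h' y\<close> h'_strict[of y z] y z assms tstar_bounds show False by simp
qed

section \<open>The scalar Halley step of \<open>h\<close>\<close>

definition newton_step :: "real \<Rightarrow> real"
  where "newton_step t = h t / - h' t"

text \<open>This equals \<open>h t * h'' t / (2 * (h' t)^2)\<close>, the scalar counterpart of
  \<open>L_op\<close>, arranged so that each factor bounds the matching factor of
  \<open>L_op\<close>.\<close>

definition L_h :: "real \<Rightarrow> real"
  where "L_h t = h'' t * newton_step t / (2 * - h' t)"

definition halley_step :: "real \<Rightarrow> real"
  where "halley_step t = newton_step t / (1 - L_h t)"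

context
  fixes t assumes t: "0 \<le> t" "t < tstar"
begin

lemma newton_step_pos: "0 < newton_step t"
  using h'_neg[of t] h_pos[OF t] t by (simp add: newton_step_def divide_pos_neg)

lemma newton_step_eq: "newton_step t * h' t = - h t"
  using h'_neg[of t] t by (simp add: newton_step_def)

lemma L_h_eq: "2 * L_h t * h' t = - (h'' t * newton_step t)"
  using h'_neg[of t] t by (simp add: L_h_def)

text \<open>At \<open>tstar - t\<close> the chord \<open>s \<mapsto> h t + h' t (1 - L_h t) s\<close>, whose zero is the Halley step,
  is already negative.\<close>

lemma halley_chord: "h t + (tstar - t) * (h' t * (1 - L_h t)) < 0"
proof -
  let ?s = "tstar - t" and ?n = "newton_step t"
  have h'': "0 < h'' t" using h''_pos t tstar_bounds by simp
  have q: "h t + ?s * h' t + ?s\<^sup>2 / 2 * h'' t \<le> 0"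
    using h_lower[of t ?s] t tstar_bounds by simp
  have "0 < ?s\<^sup>2 / 2 * h'' t" using h'' t by simp
  then have "0 < (?n - ?s) * h' t" using q newton_step_eq by (simp add: algebra_simps)
  then have n: "?n < ?s" using h'_neg[of t] t by (simp add: zero_less_mult_iff)
  \<comment> \<open>Replacing one factor \<open>?s\<close> of the quadratic Taylor term by the
    smaller Newton step turns the Taylor polynomial, nonpositive by \<open>q\<close>, into the
    chord.\<close>
  have "?s * h'' t * ?n < ?s * h'' t * ?s"
    using n h'' t by (intro mult_strict_left_mono) auto
  moreover have s: "?s * (h' t * (1 - L_h t)) = ?s * h' t + ?s * h'' t * ?n / 2"
  proof -
    have "?s * (h' t * (1 - L_h t)) = ?s * h' t - ?s * (2 * L_h t * h' t) / 2"
      by (simp add: field_simps)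
    then show ?thesis by (simp add: L_h_eq)
  qed
  moreover have "?s\<^sup>2 / 2 * h'' t = ?s * h'' t * ?s / 2"
    by (simp add: power2_eq_square)
  ultimately show ?thesis using q unfolding s by linarith
qed

text \<open>The chord starts at \<open>h t > 0\<close> and is negative at \<open>tstar - t\<close>,
  so its slope \<open>h' t * (1 - L_h t)\<close> is negative; as \<open>h' t < 0\<close>, the second
  factor is positive.\<close>

lemma L_h_bounds: "0 \<le> L_h t" "L_h t < 1"
proof -
  show "0 \<le> L_h t"
    using h'_neg[of t] newton_step_pos h''_pos[of t] t tstar_bounds by (simp add: L_h_def field_simps)
  have "(tstar - t) * (h' t * (1 - L_h t)) < 0"
    using halley_chord h_pos[OF t] by linarith
  then show "L_h t < 1" using h'_neg[of t] t by (simp add: mult_less_0_iff)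
qed

lemma halley_step_eq: "halley_step t * (1 - L_h t) = newton_step t"
  using L_h_bounds by (simp add: halley_step_def)

text \<open>The decreasing chord vanishes at the Halley step and is already negative at
  \<open>tstar - t\<close>.\<close>

lemma halley_step_less: "t + halley_step t < tstar"
proof -
  have a: "h' t * (1 - L_h t) < 0"
    using h'_neg[of t] t L_h_bounds by (simp add: mult_less_0_iff)
  have "halley_step t * (h' t * (1 - L_h t)) = - h t"
    using halley_step_eq newton_step_eq by (metis mult.assoc mult.commute)
  then have "0 < (halley_step t - (tstar - t)) * (h' t * (1 - L_h t))"
    using halley_chord by (simp add: left_diff_distrib)
  then show ?thesis using a by (smt (verit) zero_less_mult_iff)
qed

text \<open>The step is \<open>h t\<close> divided by \<open>- h' t\<close> and by
  \<open>1 - L_h t\<close>, both in (0,1]. Hence vanishing scalar increments force vanishing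
  residuals.\<close>

lemma halley_step_ge: "h t \<le> halley_step t"
proof -
  have "h t * - h' t \<le> h t * 1"
    using h'_ge[of t] h_pos[OF t] t tstar_bounds by (intro mult_left_mono) auto
  then have 1: "h t \<le> newton_step t"
    using h'_neg[of t] t unfolding newton_step_def by (subst le_divide_eq) auto
  have "newton_step t * (1 - L_h t) \<le> newton_step t * 1"
    using newton_step_pos L_h_bounds by (intro mult_left_mono) auto
  then have "newton_step t \<le> halley_step t"
    using L_h_bounds by (simp add: halley_step_def le_divide_eq)
  with 1 show ?thesis by simp
qed

lemma halley_step_pos: "0 < halley_step t"
  using halley_step_ge h_pos[OF t] by simp

text \<open>The Halley equation turns \<open>h t + s * h' t\<close> into
  \<open>- h'' t * (1 - L_h t) * s^2 / 2\<close>, where \<open>s\<close> is the step, so only the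
  part with \<open>L_h t\<close> survives. The right-hand side is exactly the bound for the main
  term in \<open>halley_step_majorized\<close>.\<close>

lemma taylor_at_halley_step:
  "h t + halley_step t * h' t + (halley_step t)\<^sup>2 / 2 * h'' t
    = h'' t * (L_h t * halley_step t) * halley_step t / 2"
proof -
  let ?s = "halley_step t"
  have ht: "h t = - (?s * (1 - L_h t) * h' t)"
    using halley_step_eq newton_step_eq by simp
  have "2 * L_h t * h' t = - (h'' t * (?s * (1 - L_h t)))"
    using L_h_eq halley_step_eq by simp
  then have "2 * L_h t * h' t * ?s = - (h'' t * (?s * (1 - L_h t))) * ?s" by simp
  with ht show ?thesis by (simp add: power2_eq_square field_simps)
qed

end

end

section \<open>Halley iteration for operators\<close>

locale halley_operator = halley_majorant h h' h'' R tstar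
  for h h' h'' :: "real \<Rightarrow> real" and R tstar :: real +
  fixes F :: "'a::banach \<Rightarrow> 'b::banach"
    and F' :: "'a \<Rightarrow> 'a \<Rightarrow>\<^sub>L 'b"
    and F'' :: "'a \<Rightarrow> 'a \<Rightarrow>\<^sub>L 'a \<Rightarrow>\<^sub>L 'b"
    and x0 :: 'a
  assumes F_deriv: "\<And>x. x \<in> ball x0 R \<Longrightarrow> (F has_derivative F' x) (at x)"
    and F'_deriv: "\<And>x. x \<in> ball x0 R \<Longrightarrow> (F' has_derivative F'' x) (at x)"
    and nonsingular_x0: "blinfun_nonsingular (F' x0)"
    and F''_majorized: "\<And>x y. x \<in> ball x0 R \<Longrightarrow> y \<in> ball x0 R \<Longrightarrow>
       norm (y - x) + norm (x - x0) < R \<Longrightarrow>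
       norm (blinfun_comp_bilinear (blinfun_inv (F' x0)) (F'' y - F'' x))
         \<le> h'' (norm (y - x) + norm (x - x0)) - h'' (norm (x - x0))"
    and F_x0: "norm (blinfun_inv (F' x0) (F x0)) \<le> h 0"
    and F''_x0: "norm (blinfun_comp_bilinear (blinfun_inv (F' x0)) (F'' x0)) \<le> h'' 0"
begin

section \<open>The operator normalized at \<open>x0\<close>\<close>

definition G :: "'a \<Rightarrow> 'a"
  where "G x = blinfun_inv (F' x0) (F x)"

definition G' :: "'a \<Rightarrow> 'a \<Rightarrow>\<^sub>L 'a"
  where "G' x = blinfun_inv (F' x0) o\<^sub>L F' x"

definition G'' :: "'a \<Rightarrow> 'a \<Rightarrow>\<^sub>L 'a \<Rightarrow>\<^sub>L 'a"
  where "G'' x = blinfun_comp_bilinear (blinfun_inv (F' x0)) (F'' x)"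

text \<open>This normalization matches \<open>h' 0 = -1\<close> and makes the majorant conditions
  bounds on plain norms of \<open>G\<close> and \<open>G''\<close>.\<close>

lemma G'_x0: "G' x0 = id_blinfun"
  by (rule blinfun_eqI) (simp add: G'_def blinfun_inv_apply[OF nonsingular_x0])

lemma G_eq_0_iff: "G x = 0 \<longleftrightarrow> F x = 0"
  using blinfun_inv_apply(1)[OF nonsingular_x0, of "F x"] by (auto simp: G_def)

lemma G_deriv:
  assumes "x \<in> ball x0 R"
  shows "(G has_derivative G' x) (at x)" "(G' has_derivative G'' x) (at x)"
proof -
  have "((\<lambda>x. blinfun_inv (F' x0) (F x)) has_derivative (\<lambda>v. blinfun_inv (F' x0) (F' x v))) (at x)"
    by (rule bounded_linear.has_derivative[OF blinfun.bounded_linear_right F_deriv[OF assms]])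
  then show "(G has_derivative G' x) (at x)"
    by (simp add: G_def[abs_def] G'_def blinfun_compose.rep_eq o_def)
  have "((\<lambda>x. blinfun_inv (F' x0) o\<^sub>L F' x) has_derivative (\<lambda>v. blinfun_inv (F' x0) o\<^sub>L F'' x v)) (at x)"
    by (rule bounded_linear.has_derivative[OF
          bounded_bilinear.bounded_linear_right[OF bounded_bilinear_blinfun_compose] F'_deriv[OF assms]])
  then show "(G' has_derivative G'' x) (at x)"
    by (simp add: G'_def[abs_def] G''_def blinfun_comp_bilinear.rep_eq)
qed

text \<open>The majorant condition involves the exact distances. Convexity of \<open>h''\<close>
  replaces \<open>norm (x - x0)\<close> by \<open>t\<close>, and monotonicity then replaces
  \<open>norm d\<close> by \<open>s\<close>.\<close>

lemma G''_increment:
  assumes "norm (x - x0) \<le> t" "norm d \<le> s" "t + s < R"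
  shows "norm (G'' (x + d) - G'' x) \<le> h'' (t + s) - h'' t"
proof -
  have b: "norm (x + d - x0) \<le> norm (x - x0) + norm d"
    using norm_triangle_ineq[of "x - x0" d] by (simp add: algebra_simps)
  have "G'' (x + d) - G'' x = blinfun_comp_bilinear (blinfun_inv (F' x0)) (F'' (x + d) - F'' x)"
    by (intro blinfun_eqI) (simp add: G''_def blinfun.bilinear_simps)
  then have "norm (G'' (x + d) - G'' x) \<le> h'' (norm (x - x0) + norm d) - h'' (norm (x - x0))"
    using F''_majorized[of x "x + d"] b assms norm_ge_zero[of d] norm_ge_zero[of "x - x0"]
    by (auto simp: dist_norm norm_minus_commute add.commute)
  also have "\<dots> \<le> h'' (t + norm d) - h'' t"
    using assms norm_ge_zero[of d] norm_ge_zero[of "x - x0"]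
    by (intro convex_on_increment_mono[OF h''_convex]) (auto simp del: norm_ge_zero)
  also have "\<dots> \<le> h'' (t + s) - h'' t"
    using assms norm_ge_zero[of d] norm_ge_zero[of "x - x0"]
    by (intro diff_right_mono h''_mono) (auto simp del: norm_ge_zero)
  finally show ?thesis .
qed

lemma G''_bound:
  assumes "norm (x - x0) \<le> t" "t < R"
  shows "norm (G'' x) \<le> h'' t"
proof -
  have "norm (G'' x - G'' x0) \<le> h'' t - h'' 0"
    using G''_increment[of x0 0 "x - x0" t] assms by simp
  moreover have "norm (G'' x0) \<le> h'' 0" using F''_x0 by (simp add: G''_def)
  ultimately show ?thesis using norm_triangle_sub[of "G'' x" "G'' x0"] by linarith
qed

section \<open>Taylor remainders along a segment\<close>

context
  fixes x d :: 'a and t s :: real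
  assumes x: "norm (x - x0) \<le> t" and d: "norm d \<le> s" and ts: "t + s < R"
begin

lemma segment_in_ball: "0 \<le> u \<Longrightarrow> u \<le> 1 \<Longrightarrow> x + u *\<^sub>R d \<in> ball x0 R"
proof -
  assume u: "0 \<le> u" "u \<le> 1"
  have "norm (x + u *\<^sub>R d - x0) \<le> norm (x - x0) + u * norm d"
    using norm_triangle_ineq[of "x - x0" "u *\<^sub>R d"] u by (simp add: algebra_simps)
  also have "u * norm d \<le> 1 * norm d" using u by (intro mult_right_mono) auto
  finally show ?thesis using x d ts by (simp add: dist_norm norm_minus_commute)
qed

lemma G_along:
  assumes "0 \<le> u" "u \<le> 1"
  shows "((\<lambda>u. G (x + u *\<^sub>R d)) has_vector_derivative G' (x + u *\<^sub>R d) d) (at u)"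
    and "((\<lambda>u. G' (x + u *\<^sub>R d)) has_vector_derivative G'' (x + u *\<^sub>R d) d) (at u)"
proof -
  have c: "((\<lambda>u. x + u *\<^sub>R d) has_derivative (\<lambda>v. v *\<^sub>R d)) (at u)"
    by (auto intro!: derivative_eq_intros)
  note G = G_deriv[OF segment_in_ball[OF assms]]
  show "((\<lambda>u. G (x + u *\<^sub>R d)) has_vector_derivative G' (x + u *\<^sub>R d) d) (at u)"
    using has_derivative_compose[OF c G(1)]
    by (simp add: has_vector_derivative_def blinfun.scaleR_right)
  show "((\<lambda>u. G' (x + u *\<^sub>R d)) has_vector_derivative G'' (x + u *\<^sub>R d) d) (at u)"
    using has_derivative_compose[OF c G(2)]
    by (simp add: has_vector_derivative_def blinfun.scaleR_right)
qed

lemma G_continuous_along: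
  "continuous_on {0..1} (\<lambda>u. G (x + u *\<^sub>R d))" "continuous_on {0..1} (\<lambda>u. G' (x + u *\<^sub>R d))"
  by (intro continuous_at_imp_continuous_on ballI
      has_vector_derivative_continuous[OF G_along(1)] has_vector_derivative_continuous[OF G_along(2)];
      simp)+

end

text \<open>The mean value inequality compares the curve \<open>?f\<close> with the real function
  \<open>?\<phi>\<close>; \<open>G''_increment\<close> dominates the derivative of the former by
  that of the latter.\<close>

lemma G'_taylor:
  assumes x: "norm (x - x0) \<le> t" and d: "norm d \<le> s" and ts: "t + s < R"
  shows "norm (G' (x + d) - G' x - G'' x d) \<le> h' (t + s) - h' t - s * h'' t"
proof (cases "s = 0")
  \<comment> \<open>Here \<open>d = 0\<close>. The case is split off because
    \<open>deriv_along\<close> requires \<open>0 < s\<close>.\<close>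
  case True
  with d show ?thesis by simp
next
  case False
  have t: "0 \<le> t" and s: "0 < s"
    using norm_ge_zero[of "x - x0"] norm_ge_zero[of d] x d False by linarith+
  let ?f = "\<lambda>u. G' (x + u *\<^sub>R d) - u *\<^sub>R G'' x d"
  let ?\<phi> = "\<lambda>u. h' (t + u * s) - u * s * h'' t"
  have "norm (?f 1 - ?f 0) \<le> ?\<phi> 1 - ?\<phi> 0"
  proof (rule differentiable_bound_general[of 0 1])
    fix u :: real assume u: "0 < u" "u < 1"
    show "(?f has_vector_derivative (G'' (x + u *\<^sub>R d) d - G'' x d)) (at u)"
      using u by (auto intro!: derivative_eq_intros G_along[OF x d ts])
    show "(?\<phi> has_vector_derivative (h'' (t + u * s) * s - s * h'' t)) (at u)"
      unfolding has_real_derivative_iff_has_vector_derivative[symmetric]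
      using u by (auto intro!: derivative_eq_intros deriv_along t s ts)
    have us: "u * s < s" "norm (u *\<^sub>R d) \<le> u * s" using u s d by auto
    have "norm (G'' (x + u *\<^sub>R d) d - G'' x d) \<le> norm (G'' (x + u *\<^sub>R d) - G'' x) * norm d"
      by (metis blinfun.diff_left norm_blinfun)
    also have "\<dots> \<le> (h'' (t + u * s) - h'' t) * s"
    proof (rule mult_mono)
      show le: "norm (G'' (x + u *\<^sub>R d) - G'' x) \<le> h'' (t + u * s) - h'' t"
        by (rule G''_increment[OF x us(2)]) (use us ts in simp)
      show "0 \<le> h'' (t + u * s) - h'' t" using order_trans[OF norm_ge_zero le] .
    qed (use d in auto)
    finally show "norm (G'' (x + u *\<^sub>R d) d - G'' x d) \<le> h'' (t + u * s) * s - s * h'' t"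
      by (simp add: algebra_simps)
  next
    show "continuous_on {0..1} ?f"
      by (intro continuous_intros G_continuous_along[OF x d ts])
    show "continuous_on {0..1} ?\<phi>"
      by (intro continuous_intros continuous_along) (use t s ts in auto)
  qed simp
  then show ?thesis by (simp add: algebra_simps)
qed

lemma G_taylor:
  assumes x: "norm (x - x0) \<le> t" and d: "norm d \<le> s" and ts: "t + s < R"
  shows "norm (G (x + d) - G x - G' x d - (1/2) *\<^sub>R G'' x d d)
    \<le> h (t + s) - h t - s * h' t - s\<^sup>2 / 2 * h'' t"
proof (cases "s = 0")
  case True
  with d show ?thesis by simp
next
  case False
  have t: "0 \<le> t" and s: "0 < s"
    using norm_ge_zero[of "x - x0"] norm_ge_zero[of d] x d False by linarith+
  let ?f = "\<lambda>u. G (x + u *\<^sub>R d) - u *\<^sub>R G' x d - (u\<^sup>2 / 2) *\<^sub>R G'' x d d"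
  let ?\<phi> = "\<lambda>u. h (t + u * s) - u * s * h' t - (u * s)\<^sup>2 / 2 * h'' t"
  have "norm (?f 1 - ?f 0) \<le> ?\<phi> 1 - ?\<phi> 0"
  proof (rule differentiable_bound_general[of 0 1])
    fix u :: real assume u: "0 < u" "u < 1"
    show "(?f has_vector_derivative (G' (x + u *\<^sub>R d) d - G' x d - u *\<^sub>R G'' x d d)) (at u)"
      using u by (auto intro!: derivative_eq_intros G_along[OF x d ts])
    show "(?\<phi> has_vector_derivative (h' (t + u * s) * s - s * h' t - (u * s) * s * h'' t)) (at u)"
      unfolding has_real_derivative_iff_has_vector_derivative[symmetric]
      using u by (auto intro!: derivative_eq_intros deriv_along t s ts simp: power2_eq_square)
    have us: "u * s < s" "norm (u *\<^sub>R d) \<le> u * s" using u s d by auto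
    \<comment> \<open>The derivative of \<open>?f\<close> is the first-order remainder of
      \<open>G'\<close> for the increment \<open>u *\<^sub>R d\<close>, applied to \<open>d\<close>,
      so \<open>G'_taylor\<close> bounds it.\<close>
    have "G' (x + u *\<^sub>R d) d - G' x d - u *\<^sub>R G'' x d d
        = (G' (x + u *\<^sub>R d) - G' x - G'' x (u *\<^sub>R d)) d"
      by (simp add: blinfun.bilinear_simps)
    then have "norm (G' (x + u *\<^sub>R d) d - G' x d - u *\<^sub>R G'' x d d)
        \<le> norm (G' (x + u *\<^sub>R d) - G' x - G'' x (u *\<^sub>R d)) * norm d"
      by (metis norm_blinfun)
    also have "\<dots> \<le> (h' (t + u * s) - h' t - (u * s) * h'' t) * s"
    proof (rule mult_mono)
      show le: "norm (G' (x + u *\<^sub>R d) - G' x - G'' x (u *\<^sub>R d)) \<le> h' (t + u * s) - h' t - (u * s) * h'' t"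
        by (rule G'_taylor[OF x us(2)]) (use us ts in simp)
      show "0 \<le> h' (t + u * s) - h' t - (u * s) * h'' t" using order_trans[OF norm_ge_zero le] .
    qed (use d in auto)
    finally show "norm (G' (x + u *\<^sub>R d) d - G' x d - u *\<^sub>R G'' x d d)
        \<le> h' (t + u * s) * s - s * h' t - (u * s) * s * h'' t"
      by (simp add: algebra_simps)
  next
    show "continuous_on {0..1} ?f"
      by (intro continuous_intros G_continuous_along[OF x d ts]) auto
    show "continuous_on {0..1} ?\<phi>"
      by (intro continuous_intros continuous_along) (use t s ts in auto)
  qed simp
  then show ?thesis by (simp add: algebra_simps)
qed

section \<open>Distance of \<open>G'\<close> from the identity, and zeros of
  \<open>G\<close>\<close>

lemma G'_near_id:
  assumes "norm (x - x0) \<le> t" "t < R"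
  shows "norm (G' x - id_blinfun) \<le> 1 + h' t"
proof -
  have t: "0 \<le> t" using norm_ge_zero assms(1) by (rule order_trans)
  \<comment> \<open>Expansion at \<open>x0\<close> with scalar base point 0; the term
    \<open>t * h'' 0\<close> cancels against the bound of the linear part.\<close>
  have "norm (G' x - id_blinfun - G'' x0 (x - x0)) \<le> h' t + 1 - t * h'' 0"
    using G'_taylor[of x0 0 "x - x0" t] assms by (simp add: G'_x0 h'_0)
  moreover have "norm (G'' x0 (x - x0)) \<le> norm (G'' x0) * norm (x - x0)" by (rule norm_blinfun)
  moreover have "\<dots> \<le> h'' 0 * t"
    using F''_x0 assms t h''_0 by (intro mult_mono) (auto simp: G''_def)
  ultimately show ?thesis
    using norm_triangle_sub[of "G' x - id_blinfun" "G'' x0 (x - x0)"] by (simp add: mult.commute)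
qed

text \<open>Solving the second-order expansion at \<open>x0\<close> for \<open>y - x0\<close> bounds
  its norm \<open>r\<close> by \<open>h r + r\<close>: the contributions of \<open>h 0\<close> and
  \<open>h'' 0\<close> cancel.\<close>

lemma majorant_nonneg_at_zero:
  assumes y: "y \<in> ball x0 R" "G y = 0"
  shows "0 \<le> h (norm (y - x0))"
proof -
  let ?d = "y - x0" and ?r = "norm (y - x0)"
  have r: "?r < R" using y by (simp add: dist_norm norm_minus_commute)
  have "norm (G y - G x0 - ?d - (1/2) *\<^sub>R G'' x0 ?d ?d) \<le> h ?r - h 0 + ?r - ?r\<^sup>2 / 2 * h'' 0"
    using G_taylor[of x0 0 ?d ?r] r by (simp add: G'_x0 h'_0)
  moreover have "?r \<le> norm (G y - G x0 - ?d - (1/2) *\<^sub>R G'' x0 ?d ?d) + norm (G x0)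
      + norm ((1/2) *\<^sub>R G'' x0 ?d ?d)"
  proof -
    define e where "e = G y - G x0 - ?d - (1/2) *\<^sub>R G'' x0 ?d ?d"
    define q where "q = (1/2) *\<^sub>R G'' x0 ?d ?d"
    have "?d = - (e + G x0 + q)" using y(2) by (simp add: e_def q_def)
    then have "?r = norm (e + G x0 + q)" by (metis norm_minus_cancel)
    also have "\<dots> \<le> norm e + norm (G x0) + norm q"
      by (rule norm_triangle_le) (simp add: norm_triangle_ineq)
    finally show ?thesis by (simp only: e_def q_def)
  qed
  moreover have "norm (G x0) \<le> h 0" using F_x0 by (simp add: G_def)
  moreover have "norm ((1/2) *\<^sub>R G'' x0 ?d ?d) \<le> ?r\<^sup>2 / 2 * h'' 0"
  proof -
    have "norm (G'' x0 ?d ?d) \<le> norm (G'' x0 ?d) * ?r" by (rule norm_blinfun)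
    also have "\<dots> \<le> (norm (G'' x0) * ?r) * ?r" by (intro mult_right_mono norm_blinfun) auto
    also have "\<dots> \<le> (h'' 0 * ?r) * ?r"
      using F''_x0 by (intro mult_right_mono) (auto simp: G''_def)
    finally show ?thesis by (simp add: power2_eq_square mult_ac)
  qed
  ultimately show ?thesis by linarith
qed

lemma G_inj_on_cball: "inj_on G (cball x0 tstar)"
proof (rule inj_onI)
  fix x y assume xy: "x \<in> cball x0 tstar" "y \<in> cball x0 tstar" "G x = G y"
  have "norm ((G x - x) - (G y - y)) \<le> (1 + h' tstar) * norm (x - y)"
  proof (rule differentiable_bound[of "cball x0 tstar" "\<lambda>x. G x - x" "\<lambda>x. blinfun_apply (G' x - id_blinfun)"])
    fix z assume z: "z \<in> cball x0 tstar"
    then have zt: "norm (z - x0) \<le> tstar" by (simp add: dist_norm norm_minus_commute)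
    then have "z \<in> ball x0 R" using tstar_bounds by (simp add: dist_norm norm_minus_commute)
    then have "((\<lambda>x. G x - x) has_derivative (\<lambda>v. G' z v - v)) (at z)"
      by (intro has_derivative_diff G_deriv has_derivative_ident)
    moreover have "blinfun_apply (G' z - id_blinfun) = (\<lambda>v. G' z v - v)"
      by (auto simp: blinfun.bilinear_simps)
    ultimately show "((\<lambda>x. G x - x) has_derivative (G' z - id_blinfun)) (at z within cball x0 tstar)"
      by (simp add: has_derivative_at_withinI)
    show "onorm (G' z - id_blinfun) \<le> 1 + h' tstar"
      using G'_near_id[OF zt] tstar_bounds by (simp add: norm_blinfun.rep_eq)
  qed (use xy in auto)
  then have "norm (x - y) \<le> (1 + h' tstar) * norm (x - y)"
    using xy(3) by (simp add: norm_minus_commute)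
  then have "0 \<le> h' tstar * norm (x - y)" by (simp add: algebra_simps)
  then show "x = y" using h'_tstar by (simp add: zero_le_mult_iff)
qed

section \<open>Bounds for one Halley step\<close>

lemma F'_nonsingular:
  assumes "norm (x - x0) \<le> t" "t \<le> tstar"
  shows "blinfun_nonsingular (F' x)"
    and "norm (blinfun_inv (F' x) y) \<le> norm (blinfun_inv (F' x0) y) / - h' t"
proof -
  have t: "0 \<le> t" using norm_ge_zero assms(1) by (rule order_trans)
  have "norm (G' x v - v) \<le> (1 + h' t) * norm v" for v
  proof -
    have "norm (G' x v - v) \<le> norm (G' x - id_blinfun) * norm v"
      using norm_blinfun[of "G' x - id_blinfun" v] by (simp add: blinfun.bilinear_simps)
    also have "\<dots> \<le> (1 + h' t) * norm v"
      using G'_near_id[of x t] assms tstar_bounds by (intro mult_right_mono) auto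
    finally show ?thesis .
  qed
  \<comment> \<open>\<open>F' x\<close> is \<open>F' x0\<close> composed with \<open>G' x\<close>,
    so it is enough to invert \<open>G' x\<close>. With \<open>q = 1 + h' t\<close> the denominator
    \<open>1 - q\<close> is \<open>- h' t\<close>.\<close>
  note N = neumann_nonsingular[of "G' x" "1 + h' t", OF this]
  have q: "0 \<le> 1 + h' t" "1 + h' t < 1"
    using h'_ge[of t] h'_neg[of t] t assms tstar_bounds by auto
  note inv0 = blinfun_inv_apply[OF nonsingular_x0] and invG = blinfun_inv_apply[OF N(1)[OF q]]
  have FG: "F' x v = F' x0 (G' x v)" for v by (simp add: G'_def inv0)
  show ns: "blinfun_nonsingular (F' x)"
    by (rule blinfun_nonsingularI[where B = "blinfun_inv (G' x) o\<^sub>L blinfun_inv (F' x0)"])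
      (simp_all add: FG inv0 invG)
  have "G' x (blinfun_inv (F' x) y) = blinfun_inv (F' x0) y"
    by (simp add: G'_def blinfun_inv_apply[OF ns])
  then have "blinfun_inv (F' x) y = blinfun_inv (G' x) (blinfun_inv (F' x0) y)"
    by (metis invG(2))
  then show "norm (blinfun_inv (F' x) y) \<le> norm (blinfun_inv (F' x0) y) / - h' t"
    using N(2)[OF q, of "blinfun_inv (F' x0) y"] by simp
qed

text \<open>The induction invariant. The strict bound \<open>t < tstar\<close> is what the facts on
  the scalar step require.\<close>

definition majorized_at :: "'a \<Rightarrow> real \<Rightarrow> bool"
  where "majorized_at x t \<longleftrightarrow> 0 \<le> t \<and> t < tstar \<and> norm (x - x0) \<le> t \<and> norm (G x) \<le> h t"

context
  fixes x t
  assumes xt: "majorized_at x t"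
begin

lemma majorized_atD: "0 \<le> t" "t < tstar" "norm (x - x0) \<le> t" "norm (G x) \<le> h t"
  using xt by (auto simp: majorized_at_def)

lemma newton_bound: "norm (blinfun_inv (F' x) (F x)) \<le> newton_step t"
proof -
  have "norm (blinfun_inv (F' x) (F x)) \<le> norm (G x) / - h' t"
    unfolding G_def using majorized_atD by (intro F'_nonsingular) auto
  also have "\<dots> \<le> h t / - h' t"
    using majorized_atD h'_neg[of t] by (intro divide_right_mono) auto
  finally show ?thesis by (simp add: newton_step_def)
qed

lemma G''_apply_bound: "norm (G'' x u v) \<le> h'' t * norm u * norm v"
proof -
  have "norm (G'' x u v) \<le> norm (G'' x u) * norm v" by (rule norm_blinfun)
  also have "\<dots> \<le> (norm (G'' x) * norm u) * norm v" by (intro mult_right_mono norm_blinfun) auto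
  also have "\<dots> \<le> (h'' t * norm u) * norm v"
    using majorized_atD tstar_bounds by (intro mult_right_mono G''_bound) auto
  finally show ?thesis .
qed

text \<open>Factor by factor: the outer inverse contributes \<open>1 / - h' t\<close>, the second
  derivative \<open>h'' t\<close>, and the inner Newton correction
  \<open>newton_step t\<close>.\<close>

lemma L_op_bound: "norm (L_op F F' F'' x v) \<le> L_h t * norm v"
proof -
  note D = majorized_atD
  let ?N = "blinfun_inv (F' x) (F x)"
  have h': "h' t < 0" "0 < h'' t" using D h'_neg[of t] h''_pos[of t] tstar_bounds by auto
  have "norm (L_op F F' F'' x v) = norm (blinfun_inv (F' x) (F'' x ?N v)) / 2"
    by (simp add: L_op_def blinfun.bilinear_simps)
  also have "\<dots> \<le> (norm (G'' x ?N v) / - h' t) / 2"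
    using F'_nonsingular(2)[OF D(3), of "F'' x ?N v"] D by (simp add: G''_def)
  also have "\<dots> \<le> ((h'' t * newton_step t * norm v) / - h' t) / 2"
  proof (intro divide_right_mono)
    have "norm (G'' x ?N v) \<le> h'' t * norm ?N * norm v" by (rule G''_apply_bound)
    also have "\<dots> \<le> h'' t * newton_step t * norm v"
      using newton_bound h' by (intro mult_right_mono mult_left_mono) auto
    finally show "norm (G'' x ?N v) \<le> h'' t * newton_step t * norm v" .
  qed (use h' in auto)
  finally show ?thesis by (simp add: L_h_def)
qed

lemma id_minus_L_op:
  "blinfun_nonsingular (id_blinfun - L_op F F' F'' x)"
  "norm (blinfun_inv (id_blinfun - L_op F F' F'' x) y) \<le> norm y / (1 - L_h t)"
proof -
  have "norm ((id_blinfun - L_op F F' F'' x) v - v) \<le> L_h t * norm v" for v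
    using L_op_bound by (simp add: blinfun.bilinear_simps)
  from neumann_nonsingular[OF this L_h_bounds[OF majorized_atD(1,2)]]
  show "blinfun_nonsingular (id_blinfun - L_op F F' F'' x)"
    "norm (blinfun_inv (id_blinfun - L_op F F' F'' x) y) \<le> norm y / (1 - L_h t)" .
qed

lemma halley_step_majorized:
  defines "d \<equiv> - blinfun_inv (id_blinfun - L_op F F' F'' x) (blinfun_inv (F' x) (F x))"
  shows "norm d \<le> halley_step t" and "majorized_at (x + d) (t + halley_step t)"
proof -
  note D = majorized_atD
  let ?N = "blinfun_inv (F' x) (F x)" and ?L = "L_op F F' F'' x" and ?s = "halley_step t"
  have "norm d \<le> norm ?N / (1 - L_h t)" using id_minus_L_op(2) by (simp add: d_def)
  also have "\<dots> \<le> halley_step t"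
    unfolding halley_step_def using newton_bound L_h_bounds[OF D(1,2)]
    by (intro divide_right_mono) auto
  finally show d: "norm d \<le> ?s" .
  have h'': "0 < h'' t" and s: "0 < ?s" "t + ?s < tstar" and L: "0 \<le> L_h t"
    using D h''_pos[of t] tstar_bounds halley_step_pos halley_step_less L_h_bounds by auto
  have "(id_blinfun - ?L) d = - ?N"
    by (simp add: d_def blinfun.minus_right blinfun_inv_apply[OF id_minus_L_op(1)])
  then have Ld: "?N + d = ?L d" by (simp add: blinfun.bilinear_simps algebra_simps)
  have ns: "blinfun_nonsingular (F' x)" using F'_nonsingular(1)[OF D(3)] D by simp
  \<comment> \<open>Applying \<open>F' x\<close> to \<open>?N + d = ?L d\<close> cancels the
    inverses and expresses the linear Taylor part through \<open>F''\<close>.\<close>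
  have "F' x (?N + d) = (1/2) *\<^sub>R F'' x ?N d"
    unfolding Ld by (simp add: L_op_def blinfun.bilinear_simps blinfun_inv_apply[OF ns])
  then have "F x + F' x d = (1/2) *\<^sub>R F'' x ?N d"
    by (simp add: blinfun.bilinear_simps blinfun_inv_apply[OF ns])
  from arg_cong[OF this, of "blinfun_inv (F' x0)"]
  have G: "G x + G' x d = (1/2) *\<^sub>R G'' x ?N d"
    by (simp add: G_def G'_def G''_def blinfun.bilinear_simps)
  \<comment> \<open>The linear Taylor part contributes \<open>?N\<close> and the quadratic one
    \<open>d\<close> in the first slot of \<open>G'' x\<close>; their sum is \<open>?L d\<close>,
    which is bounded with the small factor \<open>L_h t\<close>.\<close>
  have "G (x + d) = (1/2) *\<^sub>R G'' x (?N + d) d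
      + (G (x + d) - G x - G' x d - (1/2) *\<^sub>R G'' x d d)"
    using G by (simp add: blinfun.bilinear_simps scaleR_add_right algebra_simps)
  then have "norm (G (x + d)) \<le> norm ((1/2) *\<^sub>R G'' x (?L d) d)
      + norm (G (x + d) - G x - G' x d - (1/2) *\<^sub>R G'' x d d)"
    by (metis Ld norm_triangle_ineq)
  also have "norm ((1/2) *\<^sub>R G'' x (?L d) d) \<le> h'' t * (L_h t * ?s) * ?s / 2"
  proof -
    have "norm (?L d) \<le> L_h t * ?s"
      using order_trans[OF L_op_bound mult_left_mono[OF d L]] .
    then have "h'' t * norm (?L d) * norm d \<le> h'' t * (L_h t * ?s) * ?s"
      using h'' L s d by (intro mult_mono) auto
    with G''_apply_bound[of "?L d" d] show ?thesis by simp
  qed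
  also have "norm (G (x + d) - G x - G' x d - (1/2) *\<^sub>R G'' x d d)
      \<le> h (t + ?s) - h t - ?s * h' t - ?s\<^sup>2 / 2 * h'' t"
    using G_taylor[OF D(3) d] s tstar_bounds by simp
  \<comment> \<open>The two bounds add up to exactly \<open>h (t + ?s)\<close> by the scalar
    identity.\<close>
  finally have "norm (G (x + d)) \<le> h (t + ?s)"
    using taylor_at_halley_step[OF D(1,2)] by linarith
  moreover have "norm (x + d - x0) \<le> t + ?s"
    using norm_triangle_ineq[of "x - x0" d] D d by (simp add: algebra_simps)
  ultimately show "majorized_at (x + d) (t + ?s)"
    using s D by (simp add: majorized_at_def)
qed

end

section \<open>Comparison and convergence of the two iterations\<close>

primrec scalar_seq :: "nat \<Rightarrow> real"
  where "scalar_seq 0 = 0"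
  | "scalar_seq (Suc k) = scalar_seq k + halley_step (scalar_seq k)"

abbreviation halley :: "nat \<Rightarrow> 'a"
  where "halley \<equiv> halley_seq F F' F'' x0"

text \<open>Adding a negated term gives the shape \<open>x + d\<close> of
  \<open>halley_step_majorized\<close>.\<close>

lemma halley_Suc:
  "halley (Suc k) = halley k + - blinfun_inv (id_blinfun - L_op F F' F'' (halley k))
    (blinfun_inv (F' (halley k)) (F (halley k)))"
  by (simp add: Let_def)

lemma halley_majorized: "majorized_at (halley k) (scalar_seq k)"
proof (induction k)
  case 0
  then show ?case using F_x0 tstar_bounds by (simp add: majorized_at_def G_def)
next
  case (Suc k)
  show ?case unfolding halley_Suc scalar_seq.simps by (rule halley_step_majorized(2)[OF Suc.IH])
qed

lemmas halley_bounds = majorized_atD[OF halley_majorized]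

lemma halley_increment: "norm (halley (Suc k) - halley k) \<le> scalar_seq (Suc k) - scalar_seq k"
  unfolding halley_Suc scalar_seq.simps using halley_step_majorized(1)[OF halley_majorized] by simp

lemma halley_in_ball: "halley k \<in> ball x0 R"
  using halley_bounds[of k] tstar_bounds by (simp add: dist_norm norm_minus_commute)

lemma halley_well_defined: "ball x0 R \<subseteq> D \<Longrightarrow> halley_well_defined D F F' F'' x0"
  unfolding halley_well_defined_def
  by (intro allI conjI subsetD[OF _ halley_in_ball] id_minus_L_op(1)[OF halley_majorized]
      F'_nonsingular(1)[OF halley_bounds(3) less_imp_le[OF halley_bounds(2)]])

lemma scalar_seq_increment: "h (scalar_seq k) \<le> scalar_seq (Suc k) - scalar_seq k"
  using halley_step_ge[OF halley_bounds(1,2)] by simp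

lemma scalar_seq_convergent: "convergent scalar_seq"
proof -
  have "incseq scalar_seq"
    by (rule incseq_SucI) (use halley_step_pos[OF halley_bounds(1,2)] in \<open>simp add: less_imp_le\<close>)
  then obtain l where "scalar_seq \<longlonglongrightarrow> l"
    by (rule incseq_convergent[where B = tstar]) (blast intro: less_imp_le halley_bounds(2))
  then show ?thesis by (rule convergentI)
qed

lemma halley_converges:
  obtains xstar where "halley \<longlonglongrightarrow> xstar" "xstar \<in> cball x0 tstar" "G xstar = 0"
proof -
  obtain l where l: "scalar_seq \<longlonglongrightarrow> l" using scalar_seq_convergent by (auto simp: convergent_def)
  \<comment> \<open>Comparison with the telescoping series of the scalar increments; completeness
    then gives the limit.\<close>
  have "summable (\<lambda>k. halley (Suc k) - halley k)"
    by (rule summable_comparison_test'[OF telescope_summable[OF l] halley_increment])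
  then have "convergent (\<lambda>n. \<Sum>k<n. halley (Suc k) - halley k)"
    by (simp add: summable_iff_convergent)
  then obtain z where "(\<lambda>n. halley n - x0) \<longlonglongrightarrow> z"
    unfolding sum_lessThan_telescope by (auto simp: convergent_def)
  from tendsto_add[OF this tendsto_const[of x0]]
  have lim: "halley \<longlonglongrightarrow> z + x0" by simp
  have "halley k \<in> cball x0 tstar" for k
    using halley_bounds[of k] by (simp add: dist_norm norm_minus_commute)
  then have cball: "z + x0 \<in> cball x0 tstar"
    using closed_sequentially[OF closed_cball _ lim] by blast
  \<comment> \<open>Residuals are dominated by these increments, which vanish whatever the limit
    \<open>l\<close> is.\<close>
  have "(\<lambda>k. scalar_seq (Suc k) - scalar_seq k) \<longlonglongrightarrow> 0"
    using tendsto_diff[OF LIMSEQ_Suc[OF l] l] by simp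
  then have "(\<lambda>k. G (halley k)) \<longlonglongrightarrow> 0"
    by (rule Lim_null_comparison[OF always_eventually, rotated])
      (rule allI, rule order_trans[OF halley_bounds(4) scalar_seq_increment])
  moreover have "isCont G (z + x0)"
    using cball tstar_bounds by (intro has_derivative_continuous[OF G_deriv(1)]) auto
  then have "(\<lambda>k. G (halley k)) \<longlonglongrightarrow> G (z + x0)"
    by (rule isCont_tendsto_compose[OF _ lim])
  ultimately have "G (z + x0) = 0" using LIMSEQ_unique by blast
  with lim cball show ?thesis by (rule that)
qed

end

section \<open>Existence and uniqueness of the zero in the ball of radius \<rho>\<close>

theorem theorem4:
  fixes F :: "'a::banach \<Rightarrow> 'b::banach"
    and F' :: "'a \<Rightarrow> 'a \<Rightarrow>\<^sub>L 'b"
    and F'' :: "'a \<Rightarrow> 'a \<Rightarrow>\<^sub>L 'a \<Rightarrow>\<^sub>L 'b"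
    and D :: "'a set" and x0 :: 'a
    and h h' h'' :: "real \<Rightarrow> real" and R tstar \<rho> :: real
  assumes "D \<noteq> {}" and "open D" and "convex D"
    and "C2_on D F F' F''"
    and "x0 \<in> D" and "blinfun_nonsingular (F' x0)"
    and "R > 0" and "majorizing_function D F F' F'' x0 R h h' h''"
    and "smallest_zero h R tstar"
    and "\<rho> = Sup {t \<in> {tstar..<R}. h t \<le> 0}"
  shows "halley_well_defined D F F' F'' x0 \<and>
    (\<exists>xstar. halley_seq F F' F'' x0 \<longlonglongrightarrow> xstar \<and>
       xstar \<in> ball x0 \<rho> \<and> F xstar = 0 \<and>
       (\<forall>y\<in>ball x0 \<rho>. F y = 0 \<longrightarrow> y = xstar))"
proof -
  note M = assms(8)[unfolded majorizing_function_def]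
  from M obtain t where t: "smallest_zero h R t" "h' t < 0" by blast
  \<comment> \<open>A smallest zero is unique, so the sign of \<open>h'\<close> at the witness
    \<open>t\<close> carries over to \<open>tstar\<close>.\<close>
  have "t = tstar" using t(1) assms(9) by (force simp: smallest_zero_def intro: antisym)
  with t have h'_tstar: "h' tstar < 0" by simp
  have D: "ball x0 R \<subseteq> D" using M by blast
  interpret halley_operator h h' h'' R tstar F F' F'' x0
    by unfold_locales (use M D h'_tstar assms(4,6,9) in \<open>auto simp: C2_on_def\<close>)
  let ?S = "{t \<in> {tstar..<R}. h t \<le> 0}"
  have S: "?S \<noteq> {}" "bdd_above ?S" using tstar_bounds by (auto intro!: bdd_aboveI[of _ R])
  have "\<rho> \<le> R" unfolding assms(10) by (rule cSup_least[OF S(1)]) auto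
  \<comment> \<open>As \<open>h' tstar < 0\<close>, \<open>h\<close> is negative just to the right
    of \<open>tstar\<close>. Hence \<open>tstar < \<rho>\<close>, and the open ball of radius \<rho>
    contains the closed one of radius \<open>tstar\<close>.\<close>
  have "(h has_real_derivative h' tstar) (at tstar)"
    using h_deriv[of tstar] at_within_eq[of tstar] tstar_bounds by simp
  from DERIV_neg_dec_right[OF this h'_tstar]
  obtain e where e: "0 < e" "\<And>u. 0 < u \<Longrightarrow> u < e \<Longrightarrow> h (tstar + u) < h tstar" by blast
  define u where "u = min e (R - tstar) / 2"
  have u: "0 < u" "u < e" "tstar + u < R" using e tstar_bounds by (auto simp: u_def min_def field_simps)
  have "tstar + u \<in> ?S" using u e(2)[of u] tstar_bounds by auto
  then have "tstar + u \<le> \<rho>" unfolding assms(10) by (rule cSup_upper[OF _ S(2)])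
  then have \<rho>: "tstar < \<rho>" using u by simp
  obtain xstar where x: "halley \<longlonglongrightarrow> xstar" "xstar \<in> cball x0 tstar" "G xstar = 0"
    by (rule halley_converges)
  have "y = xstar" if y: "y \<in> ball x0 \<rho>" "F y = 0" for y
  proof -
    have G: "G y = 0" using y by (simp add: G_eq_0_iff)
    have "norm (y - x0) \<le> tstar"
    proof (rule ccontr)
      assume "\<not> norm (y - x0) \<le> tstar"
      moreover have r: "norm (y - x0) < \<rho>" using y by (simp add: dist_norm norm_minus_commute)
      \<comment> \<open>A point of the set beyond the distance of \<open>y\<close> puts that
        distance strictly between \<open>tstar\<close> and \<open>s\<close>, as \<open>h_neg\<close>
        requires.\<close>
      then obtain s where "s \<in> ?S" "norm (y - x0) < s"
        unfolding assms(10) using less_cSup_iff[OF S] by blast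
      ultimately have "h (norm (y - x0)) < 0" using h_neg[of "norm (y - x0)" s] by auto
      moreover have "y \<in> ball x0 R" using r \<open>\<rho> \<le> R\<close> by (simp add: dist_norm norm_minus_commute)
      ultimately show False using majorant_nonneg_at_zero[OF _ G] by simp
    qed
    then have "y \<in> cball x0 tstar" by (simp add: dist_norm norm_minus_commute)
    then show ?thesis using inj_onD[OF G_inj_on_cball] x G by metis
  qed
  moreover have "xstar \<in> ball x0 \<rho>" using x(2) \<rho> by simp
  ultimately show ?thesis
    using halley_well_defined[OF D] x(1,3) G_eq_0_iff by blast
qed

end
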